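(* For an integer $n\geq 3$, let $S_3(n)$ be the set of $n$-tuples $(1,\ldots,1,x,y,z)$ ($n-3$ ones) of positive integers with $2\leq x\leq y\leq z$ and $\sigma_2(1,\ldots,1,x,y,z)=\sigma_n(1,\ldots,1,x,y,z)$. Then: (1) For $n=3$ and for each integer $n\geq 5$ we have $|S_3(n)|\geq 3$. (2) For every integer $n\geq 3$, $$|S_3(n)|\geq\frac12\tau\!\left(\frac12(n-2)(3n-1)\right),$$ where $\tau(m)$ is the number of positive divisors of $m$. In particular, $\limsup_{n\to+\infty}|S_3(n)|=\limsup_{n\to+\infty}|S(n)|=+\infty$, where $S(n)$ is the set of $n$-tuples $(x_1,\ldots,x_n)$ of positive integers with $x_1\leq\cdots\leq x_n$ and $\sigma_2(x_1,\ldots,x_n)=\sigma_n(x_1,\ldots,x_n)$.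
   Context: $\sigma_k$ denotes the $k$-th elementary symmetric polynomial in $n$ variables. *)

theory Defs
  imports Complex_Main "HOL-Library.Extended_Real"
begin

text \<open>An $n$-tuple is a list of length $n$. The sum ranges over sets of positions, so repeated
  entries are counted with multiplicity.\<close>

definition esym :: "nat \<Rightarrow> nat list \<Rightarrow> nat" where
  "esym k xs = (\<Sum>I | I \<subseteq> {..<length xs} \<and> card I = k. \<Prod>i\<in>I. xs ! i)"

definition S :: "nat \<Rightarrow> nat list set" where
  "S n = {xs. length xs = n \<and> (\<forall>x\<in>set xs. 0 < x) \<and> sorted xs \<and> esym 2 xs = esym n xs}"

text \<open>Meaningful only for $n \geq 3$: for smaller $n$ the subtraction truncates.\<close>

definition S3 :: "nat \<Rightarrow> nat list set" where
  "S3 n = {replicate (n - 3) 1 @ [x, y, z] | x y z.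
     2 \<le> x \<and> x \<le> y \<and> y \<le> z \<and>
     esym 2 (replicate (n - 3) 1 @ [x, y, z]) = esym n (replicate (n - 3) 1 @ [x, y, z])}"

definition tau :: "nat \<Rightarrow> nat" where
  "tau m = card {d. 0 < d \<and> d dvd m}"

end

theory Submission
  imports Defs
begin

text \<open>For $x = 2$ and $n - 3$ ones the equation becomes
  $(y - (n-1))(z - (n-1)) = \frac12 (n-2)(3n-1)$, so every divisor pair of the right-hand side
  gives a solution. The third solution for $n = 3$ and $n \geq 5$ comes from the analogous
  factorizations for $x = 3$ and $x = 4$. The cardinalities are meaningful because the solution
  sets are finite: the product of the $n - 2$ smallest entries is at most the number of pairs
  of positions, up to a constant, and the two largest entries are then bounded in turn. Taking
  $n - 2$ a power of two makes the number of divisors unbounded.\<close>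

section \<open>Elementary symmetric polynomials of lists\<close>

lemma esym_0 [simp]: "esym 0 xs = 1"
proof -
  have "{I. I \<subseteq> {..<length xs} \<and> card I = 0} = {{}}"
    by (auto dest: finite_subset)
  then show ?thesis by (simp add: esym_def)
qed

lemma esym_Suc_Nil [simp]: "esym (Suc k) [] = 0"
  by (simp add: esym_def)

lemma esym_length: "esym (length xs) xs = prod_list xs"
proof -
  have "{I. I \<subseteq> {..<length xs} \<and> card I = length xs} = {{..<length xs}}"
    using card_subset_eq[of "{..<length xs}"] by auto
  then show ?thesis
    by (simp add: esym_def prod.list_conv_set_nth atLeast0LessThan)
qed

text \<open>Index sets are split by whether they contain position 0, and the remaining positions are
  shifted down by one. This recursion gives access to \<open>esym\<close> by list induction.\<close>

lemma esym_Suc_Cons: "esym (Suc k) (a # xs) = esym (Suc k) xs + a * esym k xs"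
proof -
  let ?n = "length xs"
  define A where "A j = {I. I \<subseteq> {..<?n} \<and> card I = j}" for j
  have finA: "finite (A j)" for j
    unfolding A_def by (rule finite_subset[of _ "Pow {..<?n}"]) auto
  have fin: "finite I" if "I \<in> A j" for I j
    using that finite_subset unfolding A_def by auto
  have split: "{I. I \<subseteq> {..<length (a # xs)} \<and> card I = Suc k}
    = (image Suc) ` A (Suc k) \<union> (\<lambda>I. insert 0 (Suc ` I)) ` A k" (is "?L = ?R")
  proof
    show "?L \<subseteq> ?R"
    proof
      fix I assume I: "I \<in> ?L"
      define J where "J = {j. Suc j \<in> I}"
      have finI: "finite I" using I finite_subset by auto
      have J: "J \<subseteq> {..<?n}" using I by (auto simp: J_def)
      then have finJ: "finite J" by (rule finite_subset) simp
      have cJ: "card (Suc ` J) = card J" by (simp add: card_image)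
      show "I \<in> ?R"
      proof (cases "0 \<in> I")
        case True
        have e: "I = insert 0 (Suc ` J)"
        proof (rule set_eqI)
          fix i show "i \<in> I \<longleftrightarrow> i \<in> insert 0 (Suc ` J)"
            using True by (cases i) (auto simp: J_def)
        qed
        have "card I = Suc (card J)" using e cJ finJ by simp
        then have "J \<in> A k" using I J by (simp add: A_def)
        then show ?thesis using e by blast
      next
        case False
        have e: "I = Suc ` J"
        proof (rule set_eqI)
          fix i show "i \<in> I \<longleftrightarrow> i \<in> Suc ` J"
            using False by (cases i) (auto simp: J_def)
        qed
        then have "J \<in> A (Suc k)" using I J cJ by (simp add: A_def)
        then show ?thesis using e by blast
      qed
    qed
    show "?R \<subseteq> ?L"
      using fin by (auto simp: A_def card_image card_insert_if)
  qed
  have inj1: "inj_on (image Suc) (A (Suc k))"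
    by (rule inj_onI) (simp add: inj_image_eq_iff)
  have inj2: "inj_on (\<lambda>I. insert 0 (Suc ` I)) (A k)"
  proof (rule inj_onI)
    fix I J assume "insert 0 (Suc ` I) = insert 0 (Suc ` J)"
    then have "Suc ` I = Suc ` J" by (metis insert_ident image_iff nat.distinct(1))
    then show "I = J" by (simp add: inj_image_eq_iff)
  qed
  have disj: "(image Suc) ` A (Suc k) \<inter> (\<lambda>I. insert 0 (Suc ` I)) ` A k = {}"
    by auto
  have "esym (Suc k) (a # xs)
    = (\<Sum>I\<in>A (Suc k). \<Prod>i\<in>Suc ` I. (a # xs) ! i)
      + (\<Sum>I\<in>A k. \<Prod>i\<in>insert 0 (Suc ` I). (a # xs) ! i)"
    unfolding esym_def split
    by (subst sum.union_disjoint) (use finA disj in \<open>auto simp: sum.reindex inj1 inj2\<close>)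
  also have "(\<Sum>I\<in>A (Suc k). \<Prod>i\<in>Suc ` I. (a # xs) ! i) = esym (Suc k) xs"
    by (simp add: esym_def A_def prod.reindex)
  also have "(\<Sum>I\<in>A k. \<Prod>i\<in>insert 0 (Suc ` I). (a # xs) ! i)
    = (\<Sum>I\<in>A k. a * (\<Prod>i\<in>I. xs ! i))"
    by (rule sum.cong) (use fin in \<open>auto simp: prod.reindex\<close>)
  also have "\<dots> = a * esym k xs"
    by (simp add: esym_def A_def sum_distrib_left)
  finally show ?thesis .
qed

lemma esym_1: "esym (Suc 0) xs = sum_list xs"
  by (induction xs) (simp_all add: esym_Suc_Cons)

lemma esym_2_Nil [simp]: "esym 2 [] = 0"
  by (simp add: numeral_2_eq_2)

lemma esym_2_Cons [simp]: "esym 2 (a # xs) = esym 2 xs + a * sum_list xs"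
  by (simp add: numeral_2_eq_2 esym_Suc_Cons esym_1)

lemma esym_2_append:
  "esym 2 (xs @ ys) = esym 2 xs + sum_list xs * sum_list ys + esym 2 ys"
  by (induction xs) (simp_all add: algebra_simps)

lemma esym_2_replicate_1: "2 * esym 2 (replicate m 1) = m * (m - 1)"
proof (induction m)
  case (Suc m)
  then show ?case by (cases m) (simp_all add: sum_list_replicate algebra_simps)
qed simp

lemma sum_list_le:
  fixes xs :: "nat list"
  assumes "\<forall>x\<in>set xs. x \<le> c"
  shows "sum_list xs \<le> length xs * c"
  using assms sum_list_mono[of xs "\<lambda>x. x" "\<lambda>_. c"] by (simp add: sum_list_triv)

text \<open>A crude count: fewer than \<open>(length xs)\<^sup>2\<close> pairs when
  \<open>xs\<close> is nonempty, each contributing at most \<open>c\<^sup>2\<close>. The finiteness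
  argument applies it twice, first with the second largest entry as \<open>c\<close>, then with a
  bound depending on \<open>n\<close> only.\<close>

lemma esym_2_le:
  assumes "\<forall>x\<in>set xs. x \<le> c"
  shows "esym 2 xs \<le> (length xs)\<^sup>2 * c\<^sup>2"
  using assms
proof (induction xs)
  case (Cons a xs)
  have s: "sum_list xs \<le> length xs * c"
    using Cons.prems by (intro sum_list_le) simp
  have "a * sum_list xs \<le> c * (length xs * c)"
    using Cons.prems s by (intro mult_mono) auto
  then have "esym 2 (a # xs) \<le> (length xs)\<^sup>2 * c\<^sup>2 + c * (length xs * c)"
    using Cons by simp
  also have "\<dots> \<le> (length (a # xs))\<^sup>2 * c\<^sup>2"
    by (simp add: power2_eq_square algebra_simps)
  finally show ?case .
qed simp

section \<open>Finiteness\<close>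

lemma member_le_prod_list:
  fixes xs :: "nat list"
  assumes "\<forall>x\<in>set xs. 0 < x" and "x \<in> set xs"
  shows "x \<le> prod_list xs"
proof -
  have "x dvd prod_list xs"
    using assms(2) by (induction xs) auto
  moreover have "prod_list xs > 0"
    using assms(1) by (induction xs) auto
  ultimately show ?thesis by (simp add: dvd_imp_le)
qed

text \<open>With the two largest entries \<open>a\<close>, \<open>b\<close> split off, the equation
  reads \<open>P * (a * b) = t + s * (a + b) + a * b\<close>. Comparing with \<open>a * b\<close>
  bounds \<open>P\<close>, hence every entry of \<open>ys\<close> and so \<open>s\<close> and
  \<open>t\<close>; then \<open>a\<close>, and finally \<open>b\<close>, are bounded through
  these.\<close>

lemma S_entries_bounded:
  assumes n: "n \<ge> 3"
  obtains B where "\<And>xs x. xs \<in> S n \<Longrightarrow> x \<in> set xs \<Longrightarrow> x \<le> B"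
proof -
  \<comment> \<open>\<open>C\<close> is n^2 + 2n + 1, the sum of the coefficients of
    \<open>a * b\<close> in the estimates of the three terms on the right. The primed constants will
    bound \<open>s\<close>, \<open>t\<close>, \<open>a\<close>, \<open>b\<close>.\<close>
  define C where "C = (n + 1)\<^sup>2"
  define s' where "s' = n * C"
  define t' where "t' = n\<^sup>2 * C\<^sup>2"
  define a' where "a' = 2 * s' + t'"
  define b' where "b' = a' * s' + t'"
  have "x \<le> C + a' + b'" if xs: "xs \<in> S n" and x: "x \<in> set xs" for xs x
  proof -
    obtain ys a b where yab: "xs = ys @ [a, b]"
    proof -
      have "length (rev xs) \<ge> 2" using xs n by (simp add: S_def)
      then obtain b a zs where "rev xs = b # a # zs"
        by (metis Suc_le_length_iff numeral_2_eq_2)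
      then have "xs = rev zs @ [a, b]"
        by (metis append_assoc append_Cons append_Nil rev.simps(2) rev_rev_ident)
      then show ?thesis using that by blast
    qed
    have len: "length ys = n - 2" and pos: "\<forall>y\<in>set ys. 0 < y" "a > 0" "b > 0"
      and le: "\<forall>y\<in>set ys. y \<le> a" "a \<le> b"
      using xs by (auto simp: S_def yab sorted_append)
    define P s t where "P = prod_list ys" and "s = sum_list ys" and "t = esym 2 ys"
    have "prod_list xs = esym 2 xs"
      using xs esym_length[of xs] by (simp add: S_def)
    then have eq: "P * (a * b) = t + s * (a + b) + a * b"
      by (simp add: yab esym_2_append P_def s_def t_def)
    \<comment> \<open>Here \<open>n \<ge> 3\<close> enters: it makes \<open>ys\<close>
      nonempty.\<close>
    have spos: "s > 0"
      using len n pos(1) by (cases ys) (auto simp: s_def)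
    have lenle: "length ys \<le> n" using len by simp
    have s1: "s \<le> n * a"
      using sum_list_le[OF le(1)] lenle unfolding s_def by (meson mult_le_mono1 order_trans)
    have "t \<le> n\<^sup>2 * a\<^sup>2"
      using esym_2_le[OF le(1)] lenle unfolding t_def
      by (meson mult_le_mono1 order_trans power_mono zero_le)
    also have "\<dots> \<le> n\<^sup>2 * (a * b)"
      using le(2) by (simp add: power2_eq_square)
    finally have t1: "t \<le> n\<^sup>2 * (a * b)" .
    have "s * (a + b) \<le> (n * a) * (b + b)"
      using s1 le(2) by (intro mult_mono) auto
    then have "P * (a * b) \<le> n\<^sup>2 * (a * b) + (n * a) * (b + b) + a * b"
      using eq t1 by linarith
    also have "\<dots> = C * (a * b)"
      by (simp add: C_def power2_eq_square algebra_simps)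
    finally have PC: "P \<le> C" using pos by simp
    then have yC: "\<forall>y\<in>set ys. y \<le> C"
      using member_le_prod_list[OF pos(1)] unfolding P_def by fastforce
    have s2: "s \<le> s'"
      using sum_list_le[OF yC] lenle unfolding s_def s'_def by (meson mult_le_mono1 order_trans)
    have t2: "t \<le> t'"
      using esym_2_le[OF yC] lenle unfolding t_def t'_def
      by (meson mult_le_mono1 order_trans power_mono zero_le)
    \<comment> \<open>Otherwise \<open>a * b\<close> on the right already accounts for the whole
      left side, leaving no room for the positive term \<open>s * (a + b)\<close>.\<close>
    have "P \<ge> 2"
    proof (rule ccontr)
      assume "\<not> P \<ge> 2"
      then have "P * (a * b) \<le> 1 * (a * b)" by (intro mult_le_mono1) simp
      moreover have "s * (a + b) > 0" using spos pos by simp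
      ultimately show False using eq by linarith
    qed
    then obtain Q where Q: "P = Suc Q" "Q \<ge> 1" by (cases P) auto
    have eq': "Q * (a * b) = t + s * (a + b)" using eq Q by simp
    \<comment> \<open>Since \<open>1 \<le> b\<close> and \<open>a \<le> b\<close>, both terms on the
      right are bounded by multiples of \<open>b\<close>, which then cancels.\<close>
    have "a * b \<le> Q * (a * b)" using Q by simp
    also have "\<dots> \<le> t * b + s * (b + b)"
      unfolding eq' using le pos by (intro add_mono mult_mono) auto
    also have "\<dots> = (2 * s + t) * b" by (simp add: algebra_simps)
    finally have "a \<le> 2 * s + t" using pos by simp
    then have a2: "a \<le> a'" using s2 t2 by (simp add: a'_def)
    have eq'': "(Q * a) * b = s * b + (a * s + t)" using eq' by (simp add: algebra_simps)
    \<comment> \<open>Solving for \<open>b\<close> gives (Qa - s) b = as + t with positive right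
      side, so the integer Qa - s is at least 1 and \<open>b \<le> a * s + t\<close>.\<close>
    have "s < Q * a"
    proof (rule ccontr)
      assume "\<not> s < Q * a"
      then have "(Q * a) * b \<le> s * b" by (intro mult_le_mono1) simp
      moreover have "a * s > 0" using spos pos by simp
      ultimately show False using eq'' by linarith
    qed
    then have "(s + 1) * b \<le> (Q * a) * b" by (intro mult_le_mono1) simp
    then have "b \<le> a * s + t" using eq'' by simp
    also have "\<dots> \<le> b'" unfolding b'_def using a2 s2 t2 by (intro add_mono mult_mono) auto
    finally have "b \<le> b'" .
    then show ?thesis using x yC a2 by (auto simp: yab)
  qed
  then show ?thesis using that by blast
qed

text \<open>Since \<open>card\<close> of an infinite set is 0, the lower bounds on cardinalities
  rest on this.\<close>

lemma finite_S:
  assumes "n \<ge> 3"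
  shows "finite (S n)"
proof -
  obtain B where B: "\<And>xs x. xs \<in> S n \<Longrightarrow> x \<in> set xs \<Longrightarrow> x \<le> B"
    using S_entries_bounded[OF assms] by blast
  have "S n \<subseteq> {xs. set xs \<subseteq> {..B} \<and> length xs = n}"
    using B by (auto simp: S_def)
  then show ?thesis
    by (rule finite_subset) (simp add: finite_lists_length_eq)
qed

lemma S3_subset_S:
  assumes "n \<ge> 3"
  shows "S3 n \<subseteq> S n"
  using assms by (auto simp: S3_def S_def sorted_append)

lemma finite_S3: "n \<ge> 3 \<Longrightarrow> finite (S3 n)"
  using finite_S S3_subset_S finite_subset by blast

section \<open>Solutions\<close>

text \<open>Both sides are doubled because the \<open>m\<close> ones contribute m(m-1)/2 pairs.
  Using \<open>m + 3\<close> for the length avoids truncated subtraction there.\<close>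

lemma mem_S3_iff:
  assumes "2 \<le> x" "x \<le> y" "y \<le> z"
  shows "replicate m 1 @ [x, y, z] \<in> S3 (m + 3) \<longleftrightarrow>
    m * (m - 1) + 2 * (m * (x + y + z) + x * y + y * z + z * x) = 2 * (x * y * z)"
proof -
  have e2: "2 * esym 2 (replicate m 1 @ [x, y, z])
    = m * (m - 1) + 2 * (m * (x + y + z) + x * y + y * z + z * x)"
    by (simp only: esym_2_append distrib_left esym_2_replicate_1)
      (cases m; simp add: sum_list_replicate algebra_simps)
  have en: "esym (m + 3) (replicate m 1 @ [x, y, z]) = x * y * z"
    using esym_length[of "replicate m 1 @ [x, y, z]"] by (simp add: numeral_3_eq_3 mult.assoc)
  have "replicate m 1 @ [x, y, z] \<in> S3 (m + 3) \<longleftrightarrow>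
    esym 2 (replicate m 1 @ [x, y, z]) = esym (m + 3) (replicate m 1 @ [x, y, z])"
    using assms by (auto simp: S3_def)
  also have "\<dots> \<longleftrightarrow> 2 * esym 2 (replicate m 1 @ [x, y, z]) = 2 * (x * y * z)"
    unfolding en by simp
  finally show ?thesis unfolding e2 .
qed

text \<open>\<open>d\<close> and \<open>e\<close> are the two factors y - (n-1) and z - (n-1) of the
  equation for x = 2.\<close>

lemma S3_two:
  assumes "n \<ge> 3" and "d \<le> e" and "2 * (d * e) = (n - 2) * (3 * n - 1)"
  shows "replicate (n - 3) 1 @ [2, n - 1 + d, n - 1 + e] \<in> S3 n"
proof -
  obtain m where m: "n = m + 3" using assms(1) by (metis add.commute le_Suc_ex)
  have "2 * (d * e) = (m + 1) * (3 * m + 8)" using assms(3) by (simp add: m)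
  moreover have "m * (m - 1) + m = m * m" by (cases m) auto
  ultimately have "replicate m 1 @ [2, m + 2 + d, m + 2 + e] \<in> S3 (m + 3)"
    using assms(2) by (subst mem_S3_iff) (simp_all add: algebra_simps)
  then show ?thesis by (simp add: m)
qed

section \<open>Three solutions for \<open>n = 3\<close> and \<open>n \<ge> 5\<close>\<close>

lemma card_ge_3I:
  assumes "finite A" "a \<in> A" "b \<in> A" "c \<in> A" "a \<noteq> b" "a \<noteq> c" "b \<noteq> c"
  shows "3 \<le> card A"
proof -
  have "card {a, b, c} \<le> card A" using assms by (intro card_mono) auto
  then show ?thesis using assms by simp
qed

text \<open>For n = 3 the equation is 1/x + 1/y + 1/z = 1.\<close>

lemma card_S3_3: "3 \<le> card (S3 3)"
proof (rule card_ge_3I)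
  show "[2, 3, 6] \<in> S3 3" using mem_S3_iff[of 2 3 6 0] by simp
  show "[2, 4, 4] \<in> S3 3" using mem_S3_iff[of 2 4 4 0] by simp
  show "[3, 3, 3] \<in> S3 3" using mem_S3_iff[of 3 3 3 0] by simp
qed (simp_all add: finite_S3)

text \<open>For n = 2k + 3 the number to factor is \<open>?N\<close>; its factorizations 1 *
  \<open>?N\<close> and (2k+1)(3k+4) differ because \<open>k \<ge> 1\<close>.\<close>

lemma card_S3_odd:
  assumes "k \<ge> 1"
  shows "3 \<le> card (S3 (2 * k + 3))"
proof (rule card_ge_3I)
  let ?r = "replicate (2 * k) (1::nat)"
  let ?N = "(2 * k + 1) * (3 * k + 4)"
  show "finite (S3 (2 * k + 3))" by (simp add: finite_S3)
  show "?r @ [2, 2 * k + 3, 2 * k + 2 + ?N] \<in> S3 (2 * k + 3)"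
    using S3_two[of "2 * k + 3" 1 ?N] by (simp add: algebra_simps numeral_eq_Suc)
  show "?r @ [2, 4 * k + 3, 5 * k + 6] \<in> S3 (2 * k + 3)"
    using S3_two[of "2 * k + 3" "2 * k + 1" "3 * k + 4"]
    by (simp add: algebra_simps numeral_eq_Suc)
  \<comment> \<open>For x = 3 the equation becomes (2y - n)(2z - n) = (n-2)(2n+3); the factors
    chosen are 2k+1 and 4k+9.\<close>
  show "?r @ [3, 2 * k + 2, 3 * k + 6] \<in> S3 (2 * k + 3)"
    using assms by (subst mem_S3_iff) (cases k; simp add: algebra_simps)+
qed (use assms in simp_all)

text \<open>For n = 2p + 2 the number to factor is p(6p+5), and \<open>p \<ge> 2\<close> separates
  the factorizations with smaller factor 1 and p. The third tuple differs from both by having x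
  other than 2.\<close>

lemma card_S3_even:
  assumes "p \<ge> 2"
  shows "3 \<le> card (S3 (2 * p + 2))"
proof -
  obtain q where p: "p = q + 2" using assms by (metis add.commute le_Suc_ex)
  let ?n = "2 * p + 2"
  let ?r = "replicate (2 * q + 3) (1::nat)"
  let ?N = "p * (6 * p + 5)"
  have n: "?n = (2 * q + 3) + 3" by (simp add: p)
  have 1: "?r @ [2, 2 * p + 2, 2 * p + 1 + ?N] \<in> S3 ?n"
    using S3_two[of ?n 1 ?N] by (simp add: p algebra_simps numeral_eq_Suc)
  have 2: "?r @ [2, 3 * p + 1, 8 * p + 6] \<in> S3 ?n"
    using S3_two[of ?n p "6 * p + 5"] by (simp add: p algebra_simps numeral_eq_Suc)
  \<comment> \<open>For x = 4 the equation becomes (3y - (n+1))(3z - (n+1)) = p(10p+27), and the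
    factors p and 10p+27 give y = p+1, z = 4p+10. For p = 2 this y is 3, below 4, so the same three
    entries are listed as 3, 4, 18.\<close>
  obtain x y z where "x \<noteq> 2" "?r @ [x, y, z] \<in> S3 ?n"
  proof (cases q)
    case 0
    then show ?thesis using that[of 3 4 18] mem_S3_iff[of 3 4 18 3] by (simp add: p)
  next
    case (Suc r)
    have "?r @ [4, p + 1, 4 * p + 10] \<in> S3 ?n"
      unfolding n by (subst mem_S3_iff) (simp_all add: p Suc algebra_simps)
    then show ?thesis using that[of 4] by simp
  qed
  then show ?thesis
    using 1 2 assms by (intro card_ge_3I[OF finite_S3 1 2]) auto
qed

lemma card_S3_ge_3:
  assumes "n = 3 \<or> n \<ge> 5"
  shows "3 \<le> card (S3 n)"
proof (cases "n = 3")
  case True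
  then show ?thesis using card_S3_3 by simp
next
  case False
  then have n: "n \<ge> 5" using assms by simp
  show ?thesis
  proof (cases "even n")
    case True
    then obtain m where "n = 2 * m" by blast
    then have "n = 2 * (m - 1) + 2" "m - 1 \<ge> 2" using n by auto
    then show ?thesis using card_S3_even by metis
  next
    case False
    then obtain m where "n = 2 * m + 1" by (elim oddE)
    then have "n = 2 * (m - 1) + 3" "m - 1 \<ge> 1" using n by auto
    then show ?thesis using card_S3_odd by metis
  qed
qed

section \<open>Counting divisors\<close>

text \<open>The map sending d to N/d takes each divisor above the square root of N to one below
  it.\<close>

lemma tau_le_twice_small_divisors:
  assumes "N > 0"
  shows "tau N \<le> 2 * card {d. d dvd N \<and> d \<le> N div d}"
proof -
  let ?L = "{d. d dvd N \<and> d \<le> N div d}"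
  have finL: "finite ?L"
    by (rule finite_subset[of _ "{d. d dvd N}"]) (use assms in auto)
  have "{d. 0 < d \<and> d dvd N} \<subseteq> ?L \<union> (\<lambda>d. N div d) ` ?L"
  proof
    fix d assume d: "d \<in> {d. 0 < d \<and> d dvd N}"
    then obtain e where e: "N = d * e" by (auto elim: dvdE)
    then have "d > 0" "e > 0" using assms by auto
    then show "d \<in> ?L \<union> (\<lambda>d. N div d) ` ?L"
      by (cases "d \<le> e") (auto simp: e intro!: image_eqI[of _ _ e])
  qed
  then have "tau N \<le> card (?L \<union> (\<lambda>d. N div d) ` ?L)"
    unfolding tau_def using finL by (intro card_mono) auto
  also have "\<dots> \<le> card ?L + card ((\<lambda>d. N div d) ` ?L)" by (rule card_Un_le)
  also have "\<dots> \<le> 2 * card ?L" using card_image_le[OF finL, of "\<lambda>d. N div d"] by simp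
  finally show ?thesis .
qed

text \<open>The ordering \<open>y \<le> z\<close> admits only divisors with d at most N/d, whence
  the factor 2. Distinct d give distinct tuples, as y = n - 1 + d.\<close>

lemma tau_le_twice_card_S3:
  assumes "n \<ge> 3"
  shows "tau ((n - 2) * (3 * n - 1) div 2) \<le> 2 * card (S3 n)"
proof -
  define N where "N = (n - 2) * (3 * n - 1) div 2"
  let ?L = "{d. d dvd N \<and> d \<le> N div d}"
  let ?f = "\<lambda>d. replicate (n - 3) 1 @ [2, n - 1 + d, n - 1 + N div d]"
  \<comment> \<open>One of the two factors is even whatever the parity of n, so \<open>div 2\<close>
    is exact.\<close>
  have "even ((n - 2) * (3 * n - 1))" using assms by (cases "even n") auto
  then have N: "2 * N = (n - 2) * (3 * n - 1)" by (simp add: N_def)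
  moreover have "(n - 2) * (3 * n - 1) > 0" using assms by simp
  ultimately have "N > 0" by linarith
  have "?f ` ?L \<subseteq> S3 n"
  proof
    fix u assume "u \<in> ?f ` ?L"
    then obtain d where d: "d dvd N" "d \<le> N div d" and u: "u = ?f d" by auto
    show "u \<in> S3 n" unfolding u by (rule S3_two[OF assms d(2)]) (use d N in simp)
  qed
  then have "card (?f ` ?L) \<le> card (S3 n)"
    by (intro card_mono finite_S3 assms)
  moreover have "inj_on ?f ?L" by (rule inj_onI) simp
  then have "card (?f ` ?L) = card ?L" by (rule card_image)
  ultimately show ?thesis
    using tau_le_twice_small_divisors[OF \<open>N > 0\<close>] unfolding N_def by linarith
qed

section \<open>Unboundedness and upper limits\<close>

lemma tau_ge_of_two_power_dvd:
  assumes "2 ^ k dvd N" and "N > 0"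
  shows "k < tau N"
proof -
  have "(\<lambda>i. 2 ^ i) ` {..k} \<subseteq> {d. 0 < d \<and> d dvd N}"
    using assms(1) by (auto intro: dvd_trans[OF le_imp_power_dvd])
  then have "card ((\<lambda>i. 2 ^ i :: nat) ` {..k}) \<le> tau N"
    unfolding tau_def using assms(2)
    by (intro card_mono) (auto intro: finite_subset[of _ "{d. d dvd N}"])
  moreover have "card ((\<lambda>i. 2 ^ i :: nat) ` {..k}) = Suc k"
    by (subst card_image) (auto intro: inj_onI)
  ultimately show ?thesis by simp
qed

lemma card_S3_unbounded: "\<exists>n\<ge>m. 3 \<le> n \<and> K \<le> card (S3 n)"
proof -
  \<comment> \<open>The summand \<open>m\<close> makes \<open>n\<close> large enough, and
    \<open>2 * K\<close> absorbs the factor 2 lost in counting. The exponent \<open>Suc k\<close> in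
    \<open>n\<close> leaves \<open>2 ^ k\<close> after halving.\<close>
  define k where "k = m + 2 * K"
  define n :: nat where "n = 2 ^ Suc k + 2"
  have "k < 2 ^ k" by (rule less_exp)
  moreover have "n = 2 * 2 ^ k + 2" by (simp add: n_def)
  ultimately have n: "n \<ge> m" "n \<ge> 3" unfolding k_def by linarith+
  have "(n - 2) * (3 * n - 1) div 2 = 2 ^ k * (3 * n - 1)" by (simp add: n_def)
  then have "k < tau ((n - 2) * (3 * n - 1) div 2)"
    using n by (simp add: tau_ge_of_two_power_dvd)
  then have "K \<le> card (S3 n)"
    using tau_le_twice_card_S3[OF n(2)] by (simp add: k_def)
  then show ?thesis using n by blast
qed

text \<open>Every tail supremum is at least every natural number \<open>K\<close>, so their infimum
  exceeds every real.\<close>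

lemma limsup_eq_infinity:
  fixes f :: "nat \<Rightarrow> nat"
  assumes "\<And>m K. \<exists>n\<ge>m. K \<le> f n"
  shows "limsup (\<lambda>n. ereal (real (f n))) = \<infinity>"
proof -
  have *: "ereal (real K) \<le> limsup (\<lambda>n. ereal (real (f n)))" for K
    unfolding limsup_INF_SUP
  proof (rule INF_greatest)
    fix m
    obtain n where "n \<ge> m" "K \<le> f n" using assms by blast
    then show "ereal (real K) \<le> (SUP n\<in>{m..}. ereal (real (f n)))"
      by (intro SUP_upper2[of n]) auto
  qed
  show ?thesis
  proof (rule ereal_top)
    fix B :: real
    have "ereal B \<le> ereal (real (nat \<lceil>B\<rceil>))" by (simp add: real_nat_ceiling_ge)
    then show "ereal B \<le> limsup (\<lambda>n. ereal (real (f n)))" using * order_trans by blast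
  qed
qed

theorem theorem3p2:
  shows "(\<forall>n::nat. n = 3 \<or> n \<ge> 5 \<longrightarrow> card (S3 n) \<ge> 3) \<and>
    (\<forall>n::nat. n \<ge> 3 \<longrightarrow>
       real (card (S3 n)) \<ge> 1 / 2 * real (tau ((n - 2) * (3 * n - 1) div 2))) \<and>
    limsup (\<lambda>n. ereal (real (card (S3 n)))) = limsup (\<lambda>n. ereal (real (card (S n)))) \<and>
    limsup (\<lambda>n. ereal (real (card (S n)))) = \<infinity>"
proof -
  have 1: "limsup (\<lambda>n. ereal (real (card (S3 n)))) = \<infinity>"
    using card_S3_unbounded by (intro limsup_eq_infinity) blast
  have "\<exists>n\<ge>m. K \<le> card (S n)" for m K
    using card_S3_unbounded[of m K] card_mono[OF finite_S S3_subset_S] order_trans by blast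
  then have 2: "limsup (\<lambda>n. ereal (real (card (S n)))) = \<infinity>"
    by (rule limsup_eq_infinity)
  have 3: "1 / 2 * real (tau ((n - 2) * (3 * n - 1) div 2)) \<le> real (card (S3 n))"
    if "n \<ge> 3" for n
    using of_nat_mono[OF tau_le_twice_card_S3[OF that], where 'a = real] by simp
  show ?thesis using 1 2 3 card_S3_ge_3 by auto
qed

end
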